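(* Let $q$ be a prime power. Pick positive integers $r$ and $n$ with $r\equiv n\pmod{q+1}$, and elements $a,b,v\in\mathbb{F}_{q^2}^*$ with $v\notin\mu_{q+1}$, and write \[ B(X) := a(X+v^{-q})^n + b(X+v)^n \in \mathbb{F}_{q^2}[X]. \] Then the polynomial $f(X):=X^r B(X^{q-1})$ permutes $\mathbb{F}_{q^2}$ (i.e., the map $c\mapsto f(c)$ is a bijection $\mathbb{F}_{q^2}\to\mathbb{F}_{q^2}$) if and only if $bv^n/a\notin\mu_{q+1}$ and $\gcd(r,q-1)=1=\gcd(n,q+1)$.
   Context: $\mu_{q+1}$ denotes the set of $(q+1)$-th roots of unity in $\mathbb{F}_{q^2}^*$. *)

theory Defs
  imports
    "HOL-Number_Theory.Number_Theory"
    "HOL-Computational_Algebra.Computational_Algebra"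
    "HOL-Library.Cardinality"
begin

definition roots_of_unity :: "nat \<Rightarrow> 'a :: field set" where
  "roots_of_unity m = {x. x \<noteq> 0 \<and> x ^ m = 1}"

definition B_poly :: "nat \<Rightarrow> nat \<Rightarrow> 'a \<Rightarrow> 'a \<Rightarrow> 'a \<Rightarrow> 'a :: field poly" where
  "B_poly q n a b v =
     smult a ((monom 1 1 + [:v powi (- int q):]) ^ n) + smult b ((monom 1 1 + [:v:]) ^ n)"

definition f_poly :: "nat \<Rightarrow> nat \<Rightarrow> nat \<Rightarrow> 'a \<Rightarrow> 'a \<Rightarrow> 'a \<Rightarrow> 'a :: field poly" where
  "f_poly q r n a b v = monom 1 r * pcompose (B_poly q n a b v) (monom 1 (q - 1))"

end

(* Write c^* for c^q and N c for c^(q+1).  For x \<noteq> 0 we may replace r by any larger R congruent to r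
   modulo q^2 - 1, so suppose r = n + k * (q + 1).  Then
     f x = \<alpha> * (N x)^k * M_u ((M_w x)^n),   M_c x = x + c * x^*,
   with w = v^* and \<alpha>, u constants such that u lies in \<mu>_(q+1) iff b * v^n / a does.  The
   F_q-linear map M_c is bijective iff N c \<noteq> 1.  So the factor M_w is harmless, M_u has to be bijective,
   and the rest is a comparison of the n-th power map on F_(q^2)^* / F_q^* with f (l * x) = l^r * f x
   for l in F_q. *)

theory Submission
  imports Defs
begin

section \<open>Powers and roots of unity in a field\<close>

lemma power_eq_1_coprime:
  fixes x :: "'a :: field"
  assumes "x ^ m = 1" "x ^ n = 1" "coprime m n"
  shows "x = 1"
proof (cases "m = 0")
  case True
  then show ?thesis using assms by simp
next
  case False
  obtain i j where "m * i = n * j + gcd m n"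
    using bezout_nat[OF False] by blast
  hence "x ^ (m * i) = x ^ (n * j) * x"
    using assms(3) by (simp add: power_add)
  thus ?thesis
    using assms(1,2) by (simp add: power_mult)
qed

text \<open>A Bezout exponent \<open>i\<close> with \<open>m * i\<close> congruent to 1 modulo
  \<open>n\<close> inverts the \<open>m\<close>-th power map on the \<open>n\<close>-th roots of
  unity.\<close>

lemma coprime_power_root:
  fixes x :: "'a :: field"
  assumes "x ^ n = 1" "coprime m n" "m > 0"
  obtains y where "y ^ n = 1" "y ^ m = x"
proof -
  obtain i j where *: "m * i = n * j + gcd m n"
    using bezout_nat[of m n] assms(3) by auto
  have "(x ^ i) ^ n = 1"
    using assms(1) by (metis mult.commute power_mult power_one)
  moreover have "(x ^ i) ^ m = x"
  proof -
    have "(x ^ i) ^ m = x ^ (m * i)"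
      by (simp only: power_mult [symmetric] mult.commute)
    also have "\<dots> = (x ^ n) ^ j * x"
      unfolding * using assms(2) by (simp add: power_add power_mult)
    finally show ?thesis using assms(1) by simp
  qed
  ultimately show ?thesis using that by blast
qed

lemma card_roots_of_power_eq_1:
  assumes "m > 0"
  shows "card {x :: 'a :: field. x ^ m = 1} \<le> m"
proof -
  let ?p = "monom (1 :: 'a) m - 1"
  have "coeff ?p m = 1"
    using assms by (simp add: coeff_1)
  hence "?p \<noteq> 0"
    by (metis coeff_0 zero_neq_one)
  moreover have "degree ?p \<le> m"
    by (intro degree_diff_le degree_monom_le) simp
  ultimately show ?thesis
    using card_poly_roots_bound[of ?p] by (simp add: poly_monom)
qed

text \<open>Otherwise X^m - 1 would have more than \<open>m\<close> roots, namely all nonzero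
  elements.\<close>

lemma exists_power_neq_1:
  assumes "0 < m" "m < CARD('a :: finite_field) - 1"
  shows "\<exists>x :: 'a. x \<noteq> 0 \<and> x ^ m \<noteq> 1"
proof (rule ccontr)
  assume "\<not> ?thesis"
  hence "- {0} \<subseteq> {x :: 'a. x ^ m = 1}" by auto
  hence "card (- {0 :: 'a}) \<le> card {x :: 'a. x ^ m = 1}"
    by (intro card_mono) auto
  also have "\<dots> \<le> m"
    by (rule card_roots_of_power_eq_1) fact
  finally show False
    using assms(2) by (simp add: Compl_eq_Diff_UNIV)
qed

section \<open>Conjugation and norm of F_(q^2) over F_q\<close>

locale quadratic_extension =
  fixes q :: nat and F :: "'a :: finite_field itself"
  assumes primepow_q: "primepow q"
    and card_F: "CARD('a) = q ^ 2"
begin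

lemma q_gt_1: "q > 1"
  using primepow_gt_Suc_0[OF primepow_q] by simp

lemma card_minus_1: "q ^ 2 - 1 = (q + 1) * (q - 1)"
  using q_gt_1 by (cases q) (auto simp: power2_eq_square)

text \<open>The characteristic is a prime dividing \<open>CARD('a) = q ^ 2\<close>, so
  \<open>q\<close> is a power of it and \<open>x ^ q\<close> is an iterated Frobenius.\<close>

lemma power_q_add: "(x + y :: 'a) ^ q = x ^ q + y ^ q"
proof -
  obtain p e where p: "prime p" "e > 0" "q = p ^ e"
    using primepow_q by (auto simp: primepow_def)
  have prime: "prime CHAR('a)"
    by (simp add: prime_CHAR_semidom)
  have "CHAR('a) dvd p ^ (e * 2)"
    using CHAR_dvd_CARD[where 'a = 'a] by (simp add: card_F p(3) power_mult)
  hence "CHAR('a) = p"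
    using prime p(1) by (meson prime_dvd_power primes_dvd_imp_eq)
  thus ?thesis
    using freshmans_dream'[OF prime] p(3) by blast
qed

lemma power_q_q: "((x :: 'a) ^ q) ^ q = x"
  using finite_field_power_card_eq_same[of x]
  by (simp add: card_F power2_eq_square power_mult)

lemma power_card_minus_1: "(x :: 'a) \<noteq> 0 \<Longrightarrow> x ^ ((q + 1) * (q - 1)) = 1"
proof -
  assume "x \<noteq> 0"
  have "x ^ (q ^ 2 - 1) * x = x ^ q ^ 2"
    using q_gt_1 by (intro power_minus_mult) simp
  also have "\<dots> = x"
    using finite_field_power_card_eq_same[of x] by (simp add: card_F)
  finally have "x ^ (q ^ 2 - 1) * x = x" .
  with \<open>x \<noteq> 0\<close> show ?thesis
    unfolding card_minus_1 by simp
qed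

text \<open>Both sides say that \<open>x\<close> lies in F_q: the left form serves linearity, the
  right one arguments on exponents.\<close>

lemma power_q_iff: "(x :: 'a) \<noteq> 0 \<Longrightarrow> x ^ q = x \<longleftrightarrow> x ^ (q - 1) = 1"
  using q_gt_1 by (cases q) auto

lemma norm_power_q: "((x :: 'a) ^ (q + 1)) ^ q = x ^ (q + 1)"
  by (simp add: power_mult_distrib power_q_q)

lemma norm_of_power_q: "((x :: 'a) ^ q) ^ (q + 1) = x ^ (q + 1)"
  by (simp add: power_q_q)

section \<open>The F_q-linear maps M_c\<close>

text \<open>This is M_c; its determinant over F_q is \<open>1 - c ^ (q + 1)\<close>.\<close>

definition twist :: "'a \<Rightarrow> 'a \<Rightarrow> 'a" where
  "twist c x = x + c * x ^ q"

lemma twist_0 [simp]: "twist c 0 = 0"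
  using q_gt_1 by (simp add: twist_def)

lemma twist_scale: "l ^ q = l \<Longrightarrow> twist c (l * x) = l * twist c x"
  by (simp add: twist_def power_mult_distrib algebra_simps)

text \<open>Conjugating the equation gives a second one, linear in \<open>x\<close> and
  \<open>x ^ q\<close>; eliminating \<open>x ^ q\<close> leaves \<open>x\<close> times the
  determinant.\<close>

lemma twist_eq_0:
  assumes "twist c x = 0" "c ^ (q + 1) \<noteq> 1"
  shows "x = 0"
proof (rule ccontr)
  assume "x \<noteq> 0"
  have "(x + c * x ^ q) ^ q = 0"
    using assms(1) q_gt_1 by (simp add: twist_def)
  hence conj: "x ^ q + c ^ q * x = 0"
    by (simp add: power_q_add power_mult_distrib power_q_q)
  have "x * (1 - c ^ (q + 1)) = (x + c * x ^ q) - c * (x ^ q + c ^ q * x)"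
    by (simp add: algebra_simps)
  also have "\<dots> = 0"
    using assms(1) conj by (simp add: twist_def)
  finally show False
    using \<open>x \<noteq> 0\<close> assms(2) by simp
qed

lemma inj_twist:
  assumes "c ^ (q + 1) \<noteq> 1"
  shows "inj (twist c)"
proof (rule injI)
  fix x y assume eq: "twist c x = twist c y"
  have "twist c (x - y) + twist c y = twist c x"
    using power_q_add[of "x - y" y] by (simp add: twist_def algebra_simps)
  hence "x - y = 0"
    using eq twist_eq_0[OF _ assms, of "x - y"] by simp
  thus "x = y" by simp
qed

text \<open>For norm 1 the image is thus confined to a proper F_q-subspace, which later refutes
  surjectivity of \<open>f\<close>.\<close>

lemma twist_power_q:
  assumes "c ^ (q + 1) = 1"
  shows "c * twist c x ^ q = twist c x"
proof -
  have "c * twist c x ^ q = c * x ^ q + c ^ (q + 1) * x"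
    by (simp add: twist_def power_q_add power_mult_distrib power_q_q algebra_simps)
  thus ?thesis
    unfolding assms by (simp add: twist_def)
qed

section \<open>Nontrivial powers, and exponents modulo q^2 - 1\<close>

lemma exists_power_q_neq: "\<exists>x :: 'a. x \<noteq> 0 \<and> x ^ q \<noteq> x"
proof -
  have "q - 1 < (q + 1) * (q - 1)"
    using q_gt_1 by (cases q) auto
  hence "\<exists>x :: 'a. x \<noteq> 0 \<and> x ^ (q - 1) \<noteq> 1"
    using q_gt_1 by (intro exists_power_neq_1) (auto simp only: card_F card_minus_1)
  thus ?thesis
    using power_q_iff by blast
qed

text \<open>The displayed power is a nontrivial \<open>d\<close>-th root of unity. Obtaining
  \<open>x\<close> rather than this root gives access to other powers of \<open>x\<close> as
  well.\<close>

lemma exists_nontrivial_root: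
  assumes "d dvd (q + 1) * (q - 1)" "d > 1"
  obtains x :: 'a where "x \<noteq> 0" "x ^ (((q + 1) * (q - 1)) div d) \<noteq> 1"
proof -
  let ?m = "((q + 1) * (q - 1)) div d"
  have pos: "(q + 1) * (q - 1) > 0"
    using q_gt_1 by auto
  have "?m * d = (q + 1) * (q - 1)"
    using assms(1) by (rule dvd_div_mult_self)
  hence "?m > 0"
    using pos by (metis gr0I mult_0 less_irrefl)
  moreover have "?m < (q + 1) * (q - 1)"
    using assms(2) pos by (rule div_less_dividend)
  ultimately show ?thesis
    using exists_power_neq_1[of ?m, where 'a = 'a] that unfolding card_F card_minus_1 by blast
qed

lemma power_shift:
  assumes "r > 0"
  shows "(x :: 'a) ^ (r + m * ((q + 1) * (q - 1))) = x ^ r"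
proof (cases "x = 0")
  case False
  have "x ^ (m * ((q + 1) * (q - 1))) = (x ^ ((q + 1) * (q - 1))) ^ m"
    by (simp only: power_mult [symmetric] mult.commute)
  thus ?thesis
    using power_card_minus_1[OF False] by (simp add: power_add)
qed (use assms in \<open>simp add: power_0_left\<close>)

end

section \<open>The map \<open>f\<close> and its factorization\<close>

locale permutation_candidate = quadratic_extension q F
  for q :: nat and F :: "'a :: finite_field itself" +
  fixes r n :: nat and a b v :: 'a
  assumes r_pos: "r > 0" and n_pos: "n > 0" and r_cong: "[r = n] (mod (q + 1))"
    and a_nz: "a \<noteq> 0" and b_nz: "b \<noteq> 0" and v_nz: "v \<noteq> 0"
    and v_norm: "v ^ (q + 1) \<noteq> 1"
begin

abbreviation f :: "'a \<Rightarrow> 'a" where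
  "f \<equiv> poly (f_poly q r n a b v)"

text \<open>For \<open>y = twist (v ^ q) x ^ n\<close>, multiplying the bracket of \<open>f\<close>
  by \<open>x ^ n\<close> gives \<open>a / (v ^ q) ^ n * y + b * y ^ q\<close>;
  \<open>\<alpha>\<close> is the first coefficient and \<open>u\<close> the second divided by the
  first.\<close>

definition u :: 'a where "u = b * (v ^ q) ^ n / a"

definition \<alpha> :: 'a where "\<alpha> = a / (v ^ q) ^ n"

lemma \<alpha>_nz: "\<alpha> \<noteq> 0"
  using a_nz v_nz by (simp add: \<alpha>_def)

text \<open>The conjugates \<open>v\<close> and \<open>v ^ q\<close> have the same norm.\<close>

lemma u_norm: "u ^ (q + 1) = (b * v ^ n / a) ^ (q + 1)"
proof -
  have "((v ^ q) ^ n) ^ (q + 1) = ((v ^ q) ^ (q + 1)) ^ n"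
    by (simp only: power_mult [symmetric] mult_ac)
  also have "\<dots> = (v ^ n) ^ (q + 1)"
    unfolding norm_of_power_q by (simp only: power_mult [symmetric] mult_ac)
  finally show ?thesis
    unfolding u_def power_divide power_mult_distrib by simp
qed

lemma f_eq: "f x = x ^ r * (a * (x ^ (q - 1) + 1 / v ^ q) ^ n + b * (x ^ (q - 1) + v) ^ n)"
  by (simp add: f_poly_def B_poly_def poly_monom poly_pcompose poly_power
      power_int_minus field_simps)

lemma f_0: "f 0 = 0"
  using r_pos by (simp add: f_eq)

lemma f_scale:
  assumes "l ^ (q - 1) = 1"
  shows "f (l * x) = l ^ r * f x"
  unfolding f_eq using assms by (simp add: power_mult_distrib)

text \<open>Multiples of q^2 - 1 do not affect the congruence modulo \<open>q + 1\<close>; adding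
  \<open>n\<close> of them makes the exponent at least \<open>n\<close>, so \<open>k\<close> is a
  natural number.\<close>

lemma shifted_exponent:
  obtains k m where "r + m * ((q + 1) * (q - 1)) = n + k * (q + 1)"
proof -
  define R where "R = r + n * ((q + 1) * (q - 1))"
  have "n * 1 \<le> n * ((q + 1) * (q - 1))"
    by (rule mult_le_mono2) (use q_gt_1 in simp)
  hence "n \<le> R"
    unfolding R_def by (metis mult_1_right trans_le_add2)
  have "[R = n + 0] (mod (q + 1))"
    unfolding R_def by (intro cong_add r_cong) (simp only: cong_0_iff dvd_mult dvd_triv_left)
  then obtain k where "R = k * (q + 1) + n"
    using \<open>n \<le> R\<close> by (auto simp: cong_le_nat)
  thus ?thesis
    using that[of n k] by (simp add: R_def)
qed

text \<open>The factor \<open>x ^ n\<close> of \<open>x ^ r\<close> is absorbed into the two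
  \<open>n\<close>-th powers. Their bases become \<open>twist (v ^ q) x / v ^ q\<close> and the
  conjugate of \<open>twist (v ^ q) x\<close>.\<close>

lemma f_factorization:
  assumes km: "r + m * ((q + 1) * (q - 1)) = n + k * (q + 1)"
  shows "f x = \<alpha> * (x ^ (q + 1)) ^ k * twist u (twist (v ^ q) x ^ n)"
proof -
  have xq: "x * x ^ (q - Suc 0) = x ^ q"
    using q_gt_1 by (simp flip: power_Suc)
  have "x ^ r = x ^ n * (x ^ (q + 1)) ^ k"
  proof -
    have "x ^ r = x ^ (n + k * (q + 1))"
      using power_shift[OF r_pos, of x m] km by simp
    also have "\<dots> = x ^ n * (x ^ (q + 1)) ^ k"
      by (simp only: power_add [of x n] power_mult [symmetric] mult.commute)
    finally show ?thesis .
  qed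
  hence "x ^ r * (a * y ^ n + b * z ^ n) = (x ^ (q + 1)) ^ k * (a * (x * y) ^ n + b * (x * z) ^ n)"
    for y z by (simp add: power_mult_distrib algebra_simps)
  hence "f x = (x ^ (q + 1)) ^ k *
    (a * (x * (x ^ (q - 1) + 1 / v ^ q)) ^ n + b * (x * (x ^ (q - 1) + v)) ^ n)"
    unfolding f_eq by blast
  also have "x * (x ^ (q - 1) + 1 / v ^ q) = twist (v ^ q) x / v ^ q"
    using v_nz by (simp add: twist_def distrib_left xq add_divide_distrib add.commute)
  also have "x * (x ^ (q - 1) + v) = twist (v ^ q) x ^ q"
    by (simp add: twist_def power_q_add power_mult_distrib power_q_q distrib_left xq mult.commute)
  also have "a * (twist (v ^ q) x / v ^ q) ^ n + b * (twist (v ^ q) x ^ q) ^ n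
    = \<alpha> * twist u (twist (v ^ q) x ^ n)"
  proof -
    have "(twist (v ^ q) x ^ q) ^ n = (twist (v ^ q) x ^ n) ^ q"
      by (simp only: power_mult [symmetric] mult.commute)
    thus ?thesis
      using v_nz a_nz unfolding twist_def[of u] unfolding u_def \<alpha>_def
      by (simp add: power_divide field_simps)
  qed
  finally show ?thesis by (simp add: mult_ac)
qed

lemma v_conj_norm: "(v ^ q) ^ (q + 1) \<noteq> 1"
  unfolding norm_of_power_q by (rule v_norm)

section \<open>Sufficiency of the conditions\<close>

lemma inj_f:
  assumes u: "u ^ (q + 1) \<noteq> 1" and r: "coprime r (q - 1)" and n: "coprime n (q + 1)"
  shows "inj f"
proof -
  obtain k m where km: "r + m * ((q + 1) * (q - 1)) = n + k * (q + 1)"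
    by (rule shifted_exponent)
  let ?L = "twist (v ^ q)"
  have L_nz: "?L x \<noteq> 0" if "x \<noteq> 0" for x
    using twist_eq_0[OF _ v_conj_norm] that by blast
  have f_nz: "f x \<noteq> 0" if "x \<noteq> 0" for x
    using twist_eq_0[OF _ u, of "?L x ^ n"] L_nz[OF that] that \<alpha>_nz
    by (auto simp: f_factorization[OF km])
  have "x = y" if eq: "f x = f y" and nz: "x \<noteq> 0" "y \<noteq> 0" for x y
  proof -
    define l where "l = ?L x / ?L y"
    have l_nz: "l \<noteq> 0"
      using nz L_nz by (simp add: l_def)
    have fixed: "((z ^ (q + 1)) ^ k) ^ q = (z ^ (q + 1)) ^ k" for z :: 'a
      using norm_power_q[of z] by (metis power_mult mult.commute)
    \<comment> \<open>Powers of norms lie in F_q, so they move inside \<open>twist u\<close>, which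
      can then be cancelled.\<close>
    have "twist u ((x ^ (q + 1)) ^ k * ?L x ^ n) = twist u ((y ^ (q + 1)) ^ k * ?L y ^ n)"
      using eq \<alpha>_nz
      unfolding f_factorization[OF km] twist_scale[OF fixed] mult.assoc
      by (simp only: mult_cancel_left simp_thms)
    hence "(x ^ (q + 1)) ^ k * ?L x ^ n = (y ^ (q + 1)) ^ k * ?L y ^ n"
      using inj_twist[OF u] by (simp add: inj_eq)
    \<comment> \<open>Raising to the power \<open>q - 1\<close> kills factors from F_q^* and maps
      the quotient by F_q^* into the (q+1)-th roots of unity, where \<open>n\<close>-th powers are
      injective.\<close>
    hence "((x ^ (q + 1)) ^ k * ?L x ^ n) ^ (q - 1) = ((y ^ (q + 1)) ^ k * ?L y ^ n) ^ (q - 1)"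
      by simp
    moreover have "((z ^ (q + 1)) ^ k) ^ (q - 1) = 1" if "z \<noteq> 0" for z :: 'a
      using power_card_minus_1[OF that] by (metis mult.commute power_mult power_one)
    ultimately have "(?L x ^ n) ^ (q - 1) = (?L y ^ n) ^ (q - 1)"
      using nz by (simp add: power_mult_distrib)
    hence "(l ^ (q - 1)) ^ n = 1"
      using L_nz[OF nz(2)]
      by (simp add: l_def power_divide power_mult [symmetric] mult.commute)
    moreover have "(l ^ (q - 1)) ^ (q + 1) = 1"
      using power_card_minus_1[OF l_nz] by (metis mult.commute power_mult)
    ultimately have l1: "l ^ (q - 1) = 1"
      using n by (rule power_eq_1_coprime)
    \<comment> \<open>Since \<open>l\<close> is in F_q, linearity turns the ratio of the images into
      the ratio of \<open>x\<close> and \<open>y\<close>.\<close>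
    hence "?L (l * y) = l * ?L y"
      by (intro twist_scale) (simp add: power_q_iff[OF l_nz])
    hence "?L x = ?L (l * y)"
      using L_nz[OF nz(2)] by (simp add: l_def)
    hence xl: "x = l * y"
      using inj_twist[OF v_conj_norm] by (simp add: inj_eq)
    hence "l ^ r = 1"
      using eq f_scale[OF l1, of y] f_nz[OF nz(2)] by simp
    hence "l = 1"
      using l1 r by (rule power_eq_1_coprime)
    thus "x = y" by (simp add: xl)
  qed
  thus ?thesis
    using f_0 f_nz by (metis injI)
qed

section \<open>Necessity of the conditions\<close>

text \<open>A common divisor \<open>d > 1\<close> yields \<open>l \<noteq> 1\<close> in F_q^* with
  \<open>l ^ r = 1\<close>, hence \<open>f l = f 1\<close>.\<close>

lemma coprime_r_of_inj_f:
  assumes "inj f"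
  shows "coprime r (q - 1)"
proof (rule ccontr)
  define d where "d = gcd r (q - 1)"
  assume "\<not> coprime r (q - 1)"
  hence d: "d > 1"
    using r_pos
    by (metis d_def coprime_iff_gcd_eq_1 gcd_eq_0_iff less_one linorder_neqE_nat less_irrefl)
  have dvd: "d dvd (q + 1) * (q - 1)"
    by (simp add: d_def)
  obtain x :: 'a where x: "x \<noteq> 0" "x ^ (((q + 1) * (q - 1)) div d) \<noteq> 1"
    using exists_nontrivial_root[OF dvd d] by blast
  define l where "l = x ^ (((q + 1) * (q - 1)) div d)"
  have ld: "l ^ d = 1"
    unfolding l_def power_mult [symmetric] dvd_div_mult_self[OF dvd]
    by (rule power_card_minus_1[OF x(1)])
  have l_dvd: "l ^ e = 1" if "d dvd e" for e
    using that ld by (auto simp: dvd_def power_mult)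
  have "l ^ r = 1" "l ^ (q - 1) = 1"
    by (rule l_dvd; simp add: d_def)+
  hence "f (l * 1) = f 1"
    using f_scale[of l 1] by simp
  thus False
    using assms x(2) by (simp add: inj_eq l_def)
qed

lemma coprime_n_of_inj_f:
  assumes inj: "inj f"
  shows "coprime n (q + 1)"
proof (rule ccontr)
  define d where "d = gcd n (q + 1)"
  assume "\<not> coprime n (q + 1)"
  hence d: "d > 1"
    using n_pos
    by (metis d_def coprime_iff_gcd_eq_1 gcd_eq_0_iff less_one linorder_neqE_nat less_irrefl)
  have d1: "d dvd q + 1"
    by (simp add: d_def)
  \<comment> \<open>an element p with p^n, but not p, in the base field; scaling the value of \<open>twist (v ^ q)\<close>
    by p changes f only by a factor in the base field, which can be undone as r is coprime to q - 1\<close>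
  obtain y :: 'a where y: "y \<noteq> 0" "y ^ (((q + 1) * (q - 1)) div d) \<noteq> 1"
    using exists_nontrivial_root[OF dvd_mult2[OF d1] d] by blast
  define p where "p = y ^ ((q + 1) div d)"
  have p_nz: "p \<noteq> 0"
    using y by (simp add: p_def)
  have p1: "p ^ (q - 1) \<noteq> 1"
    using y(2) unfolding p_def power_mult [symmetric] dvd_div_mult[OF d1] .
  have pd: "(p ^ d) ^ (q - 1) = 1"
    unfolding p_def power_mult [symmetric] dvd_div_mult_self[OF d1]
    by (rule power_card_minus_1[OF y(1)])
  have "n = d * (n div d)"
    by (simp add: d_def)
  hence "(p ^ n) ^ (q - 1) = ((p ^ d) ^ (q - 1)) ^ (n div d)"
    by (metis mult.assoc mult.commute power_mult)
  hence pn: "(p ^ n) ^ (q - 1) = 1"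
    by (simp only: pd power_one)

  obtain k m where km: "r + m * ((q + 1) * (q - 1)) = n + k * (q + 1)"
    by (rule shifted_exponent)
  let ?L = "twist (v ^ q)"
  have "bij ?L"
    using inj_twist[OF v_conj_norm] finite_UNIV_inj_surj[of ?L] by (simp add: bij_def)
  then obtain x where x: "?L x = p * ?L 1"
    by (metis bij_pointE)
  have L1: "?L 1 \<noteq> 0"
    using twist_eq_0[OF _ v_conj_norm, of 1] by auto
  have "x \<noteq> 0"
    using x L1 p_nz by auto
  define t where "t = (x ^ (q + 1)) ^ k * p ^ n"
  have "((x ^ (q + 1)) ^ k) ^ (q - 1) = 1"
    using power_card_minus_1[OF \<open>x \<noteq> 0\<close>] by (metis mult.commute power_mult power_one)
  hence t1: "t ^ (q - 1) = 1"
    using pn by (simp add: t_def power_mult_distrib)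
  have pq: "(p ^ n) ^ q = p ^ n"
    using pn p_nz by (simp add: power_q_iff)
  have fx: "f x = t * f 1"
    by (simp add: f_factorization[OF km] x t_def power_mult_distrib twist_scale[OF pq] mult_ac)
  obtain l where l: "l ^ (q - 1) = 1" "l ^ r = t"
    using coprime_power_root[OF t1 coprime_r_of_inj_f[OF inj] r_pos] by blast
  have "f x = f (l * 1)"
    using f_scale[OF l(1), of 1] fx l(2) by simp
  hence "x = l * 1"
    using inj by (simp only: inj_eq)
  moreover have "l \<noteq> 0"
    using l(1) q_gt_1 by (auto simp: power_0_left)
  \<comment> \<open>Now \<open>x = l\<close> lies in F_q, so linearity forces \<open>p = l\<close>,
    although \<open>p\<close> is outside F_q.\<close>
  ultimately have "p * ?L 1 = l * ?L 1"
    using x twist_scale[of l "v ^ q" 1] l(1) power_q_iff[of l] by simp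
  thus False
    using L1 l(1) p1 by simp
qed

text \<open>For \<open>u\<close> of norm 1, every value of \<open>f\<close> divided by
  \<open>\<alpha>\<close> solves \<open>u * z ^ q = z\<close>, as the norm factor lies in F_q. If
  all \<open>z\<close> did, then \<open>z = 1\<close> would give \<open>u = 1\<close>, and
  conjugation would be trivial.\<close>

lemma u_norm_of_surj_f:
  assumes "surj f"
  shows "u ^ (q + 1) \<noteq> 1"
proof
  assume u: "u ^ (q + 1) = 1"
  obtain k m where km: "r + m * ((q + 1) * (q - 1)) = n + k * (q + 1)"
    by (rule shifted_exponent)
  have *: "u * z ^ q = z" for z
  proof -
    obtain x where x: "f x = \<alpha> * z"
      using assms by (metis surjD)
    let ?N = "(x ^ (q + 1)) ^ k"
    have z: "z = ?N * twist u (twist (v ^ q) x ^ n)"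
      using x \<alpha>_nz by (simp add: f_factorization[OF km])
    have "?N ^ q = ?N"
      using norm_power_q[of x] by (metis power_mult mult.commute)
    thus ?thesis
      using twist_power_q[OF u, of "twist (v ^ q) x ^ n"]
      unfolding z power_mult_distrib by (simp add: mult.left_commute)
  qed
  have "u = 1"
    using *[of 1] by simp
  thus False
    using * exists_power_q_neq by auto
qed

end

theorem theorem1p2:
  fixes q r n :: nat and a b v :: "'a :: finite_field"
  assumes "primepow q"
    and "CARD('a) = q ^ 2"
    and "r > 0" and "n > 0"
    and "[r = n] (mod (q + 1))"
    and "a \<noteq> 0" and "b \<noteq> 0" and "v \<noteq> 0"
    and "v \<notin> roots_of_unity (q + 1)"
  shows "bij (poly (f_poly q r n a b v)) \<longleftrightarrow>
           b * v ^ n / a \<notin> roots_of_unity (q + 1) \<and> gcd r (q - 1) = 1 \<and> gcd n (q + 1) = 1"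
proof -
  interpret permutation_candidate q "TYPE('a)" r n a b v
    by unfold_locales (use assms in \<open>auto simp: roots_of_unity_def\<close>)
  have "b * v ^ n / a \<notin> roots_of_unity (q + 1) \<longleftrightarrow> u ^ (q + 1) \<noteq> 1"
    unfolding u_norm using assms(6-8) by (simp add: roots_of_unity_def)
  moreover have "bij f \<longleftrightarrow> inj f"
    using finite_UNIV_inj_surj[of f] by (auto simp: bij_def)
  moreover have "inj f \<Longrightarrow> surj f"
    by (simp add: finite_UNIV_inj_surj)
  ultimately show ?thesis
    using inj_f coprime_r_of_inj_f coprime_n_of_inj_f u_norm_of_surj_f
    unfolding coprime_iff_gcd_eq_1 by metis
qed

end
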